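(* Let $q\ge 27$ be a prime power with $q\equiv 3\pmod 4$, let $\xi$ be a primitive element of $F_q$, and let $J$ be an integer with $(q-3)/4\le J\le (q-3)/2$. Let $\mathcal{C}$ be the conic $x_1^2=x_0x_2$, $\mathcal{D}_J=\{(1,\xi^d,\xi^{2d}): d=0,1,\dots,J\}\subset\mathcal{C}$, $P=(0,1,0)$, $Z=(1,0,-1)$, $B_J=(1,0,-\xi^{2J})$, $\mathcal{E}_J=\mathcal{D}_J\cup\{P,Z,B_J\}$, and let $\ell_1$ be the line $x_1=0$. Then every point of $\ell_1\cup(\mathcal{C}\setminus\mathcal{D}_J)$ lies on a bisecant of $\mathcal{E}_J$.
   Context: Points of $PG(2,q)$ are in homogeneous coordinates $(x_0,x_1,x_2)$. A bisecant of a point set is a line through two of its distinct points. *)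

theory Defs
  imports "HOL-Analysis.Cartesian_Space" "HOL-Number_Theory.Number_Theory"
begin

text \<open>
  The projective plane over a field \<open>'a\<close>: a point is the one-dimensional subspace of
  \<open>'a ^ 3\<close> spanned by any of its homogeneous coordinate vectors, so the coordinates
  \<open>x\<^sub>0, x\<^sub>1, x\<^sub>2\<close> are the components with index 1, 2, 3.
  A line is the set of its points.
\<close>

definition hpoint :: "'a::field \<Rightarrow> 'a \<Rightarrow> 'a \<Rightarrow> ('a ^ 3) set" where
  "hpoint x0 x1 x2 = vec.span {vector [x0, x1, x2]}"

definition hline :: "'a::field \<Rightarrow> 'a \<Rightarrow> 'a \<Rightarrow> ('a ^ 3) set set" where
  "hline a0 a1 a2 =
    {hpoint x0 x1 x2 | x0 x1 x2.
       (x0, x1, x2) \<noteq> (0, 0, 0) \<and> a0 * x0 + a1 * x1 + a2 * x2 = 0}"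

definition is_line :: "('a::field ^ 3) set set \<Rightarrow> bool" where
  "is_line l \<longleftrightarrow> (\<exists>a0 a1 a2. (a0, a1, a2) \<noteq> (0, 0, 0) \<and> l = hline a0 a1 a2)"

definition bisecant :: "('a::field ^ 3) set set \<Rightarrow> ('a ^ 3) set set \<Rightarrow> bool" where
  "bisecant S l \<longleftrightarrow> is_line l \<and> (\<exists>A\<in>S. \<exists>B\<in>S. A \<noteq> B \<and> A \<in> l \<and> B \<in> l)"

definition primitive_element :: "'a::{field, finite} \<Rightarrow> bool" where
  "primitive_element g \<longleftrightarrow> range (\<lambda>n::nat. g ^ n) = UNIV - {0}"

definition conic :: "('a::field ^ 3) set set" where
  "conic = {hpoint x0 x1 x2 | x0 x1 x2. (x0, x1, x2) \<noteq> (0, 0, 0) \<and> x1\<^sup>2 = x0 * x2}"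

definition D_set :: "'a::field \<Rightarrow> nat \<Rightarrow> ('a ^ 3) set set" where
  "D_set \<xi> J = {hpoint 1 (\<xi> ^ d) (\<xi> ^ (2 * d)) | d. d \<le> J}"

definition E_set :: "'a::field \<Rightarrow> nat \<Rightarrow> ('a ^ 3) set set" where
  "E_set \<xi> J =
    D_set \<xi> J \<union> {hpoint 0 1 0, hpoint 1 0 (- 1), hpoint 1 0 (- (\<xi> ^ (2 * J)))}"

end

theory Submission
  imports Defs
begin

text \<open>
  The line \<open>x\<^sub>1 = 0\<close> is itself the bisecant through \<open>Z\<close> and \<open>B\<^sub>J\<close>, and it contains the two
  points of the conic with \<open>x\<^sub>1 = 0\<close>. Every other point of the conic is \<open>(1, t, t\<^sup>2)\<close> with
  \<open>t = \<xi>\<^sup>n\<close>. The line joining \<open>(1, s, s\<^sup>2)\<close> and \<open>(1, t, t\<^sup>2)\<close> passes through \<open>P\<close>, \<open>Z\<close> or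
  \<open>B\<^sub>J\<close> if \<open>s = - t\<close>, \<open>s t = 1\<close> or \<open>s t = \<xi>\<^bsup>2J\<^esup>\<close>, respectively. Hence the lines
  joining these three points to \<open>\<D>\<^sub>J\<close> cover the exponents \<open>n\<close> in
  \<open>[0, J]\<close>, \<open>[J, 2J]\<close>, \<open>[(q-1)/2, (q-1)/2 + J]\<close> and \<open>[q-1-J, q-1]\<close>, and these
  intervals leave no gap when \<open>(q-3)/4 \<le> J\<close>.
\<close>

lemma hpoint_eqD:
  assumes "hpoint a b c = hpoint a' b' (c'::'a::field)"
  shows "\<exists>k. a = k * a' \<and> b = k * b' \<and> c = k * c'"
proof -
  have "vector [a, b, c] \<in> hpoint a' b' c'"
    using assms by (metis hpoint_def insertI1 vec.span_base)
  then obtain k where "(vector [a, b, c] :: 'a ^ 3) = k *s vector [a', b', c']"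
    by (auto simp: hpoint_def vec.span_singleton)
  then show ?thesis
    by (auto simp: vec_eq_iff forall_3)
qed

lemma hpoint_in_hline:
  "(x0, x1, x2) \<noteq> (0, 0, 0) \<Longrightarrow> a0 * x0 + a1 * x1 + a2 * x2 = 0 \<Longrightarrow>
    hpoint x0 x1 x2 \<in> hline a0 a1 a2"
  unfolding hline_def by blast

lemma primitive_element_nonzero:
  assumes "primitive_element \<xi>"
  shows "\<xi> \<noteq> 0"
proof
  assume "\<xi> = 0"
  moreover have "\<xi> ^ 1 \<in> UNIV - {0}"
    using assms unfolding primitive_element_def by blast
  ultimately show False by simp
qed

lemma range_power_eq_image:
  fixes g :: "'a::monoid_mult"
  assumes "g ^ k = 1" "0 < k"
  shows "range (\<lambda>n. g ^ n) = (\<lambda>n. g ^ n) ` {..<k}"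
proof -
  have "g ^ n = g ^ (n mod k)" for n
  proof -
    have "g ^ n = g ^ (k * (n div k) + n mod k)" by simp
    also have "\<dots> = g ^ (n mod k)"
      using assms(1) by (simp only: power_add power_mult) simp
    finally show ?thesis .
  qed
  then show ?thesis
    using assms(2) by (auto intro!: image_eqI[where x = "_ mod k"])
qed

text \<open>A shorter period \<open>k\<close> would leave at most \<open>k\<close> distinct powers,
  too few to fill the multiplicative group.\<close>

lemma primitive_element_power_ne_1:
  fixes \<xi> :: "'a::{field, finite}"
  assumes "primitive_element \<xi>" "0 < k" "k < CARD('a) - 1"
  shows "\<xi> ^ k \<noteq> 1"
proof
  assume "\<xi> ^ k = 1"
  then have "UNIV - {0} = (\<lambda>n. \<xi> ^ n) ` {..<k}"
    using assms range_power_eq_image unfolding primitive_element_def by metis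
  then have "card (UNIV - {0::'a}) \<le> k"
    by (metis card_image_le card_lessThan finite_lessThan)
  then show False
    using assms(3) by (simp add: card_Diff_singleton)
qed

text \<open>Pigeonhole: the exponents up to \<open>?N\<close> outnumber the nonzero elements, so two
  powers coincide. Their difference is a period of at most \<open>?N\<close>, and the previous lemma
  excludes a smaller one.\<close>

lemma primitive_element_power_card:
  fixes \<xi> :: "'a::{field, finite}"
  assumes "primitive_element \<xi>"
  shows "\<xi> ^ (CARD('a) - 1) = 1"
proof -
  let ?N = "CARD('a) - 1"
  have nz: "\<xi> \<noteq> 0" using assms by (rule primitive_element_nonzero)
  have "card ((\<lambda>n. \<xi> ^ n) ` {..?N}) \<le> card (UNIV - {0::'a})"
    using nz by (intro card_mono) auto
  then have "card ((\<lambda>n. \<xi> ^ n) ` {..?N}) < card {..?N}"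
    by (simp only: card_atMost) (simp add: card_Diff_singleton less_Suc_eq_le del: Suc_pred)
  then have "\<not> inj_on (\<lambda>n. \<xi> ^ n) {..?N}"
    by (rule pigeonhole)
  then obtain i j where ij: "i < j" "j \<le> ?N" "\<xi> ^ i = \<xi> ^ j"
    by (metis (mono_tags, lifting) linorder_inj_onI' atMost_iff)
  have "\<xi> ^ i * \<xi> ^ (j - i) = \<xi> ^ i * 1"
    using ij(3) power_add[of \<xi> i "j - i"] ij(1) by simp
  then have "\<xi> ^ (j - i) = 1"
    using nz by simp
  moreover from this have "\<not> j - i < ?N"
    using ij(1) primitive_element_power_ne_1[OF assms, of "j - i"] by auto
  then have "j - i = ?N" using ij(2) by auto
  ultimately show ?thesis by simp
qed

lemma primitive_element_power_half:
  fixes \<xi> :: "'a::{field, finite}"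
  assumes "primitive_element \<xi>" "2 * m = CARD('a) - 1" "0 < m"
  shows "\<xi> ^ m = - 1"
proof -
  have "(\<xi> ^ m)\<^sup>2 = 1"
    using primitive_element_power_card[OF assms(1)] assms(2)
    by (simp add: mult.commute flip: power_mult)
  moreover have "\<xi> ^ m \<noteq> 1"
    using assms by (intro primitive_element_power_ne_1) auto
  ultimately show ?thesis
    by (simp add: power2_eq_1_iff)
qed

lemma obtain_primitive_element_exponent:
  fixes \<xi> :: "'a::{field, finite}"
  assumes "primitive_element \<xi>" "t \<noteq> 0"
  obtains n where "n < CARD('a) - 1" "t = \<xi> ^ n"
proof -
  have "card {0, 1::'a} \<le> CARD('a)" by (intro card_mono) auto
  then have "0 < CARD('a) - 1" by simp
  then have "UNIV - {0} = (\<lambda>n. \<xi> ^ n) ` {..<CARD('a) - 1}"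
    using assms(1) range_power_eq_image primitive_element_power_card
    unfolding primitive_element_def by metis
  with assms(2) that show ?thesis by blast
qed

lemma D_point_in_E_set: "d \<le> J \<Longrightarrow> hpoint 1 (\<xi> ^ d) ((\<xi> ^ d)\<^sup>2) \<in> E_set \<xi> J"
  by (auto simp: E_set_def D_set_def mult.commute simp flip: power_mult)

text \<open>With s = \<open>\<xi> ^ d\<close>, this line meets the conic in (1, s, s^2) and (1, -s,
  s^2).\<close>

lemma bisecant_through_P:
  assumes "d \<le> J"
  shows "bisecant (E_set \<xi> J) (hline (- (\<xi> ^ d)\<^sup>2) 0 1)"
  unfolding bisecant_def
proof (intro conjI bexI)
  show "is_line (hline (- (\<xi> ^ d)\<^sup>2) 0 1)"
    unfolding is_line_def by (metis prod.inject zero_neq_one)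
  show "hpoint 1 (\<xi> ^ d) ((\<xi> ^ d)\<^sup>2) \<noteq> hpoint 0 1 0"
    by (auto dest: hpoint_eqD)
qed (use assms D_point_in_E_set in \<open>auto simp: E_set_def intro!: hpoint_in_hline\<close>)

text \<open>Put s = \<open>\<xi> ^ d\<close>. On (1, X, X^2) the linear form is X^2 - (s + t) X + s
  t = (X - s)(X - t), so the line also contains (1, t, t^2). If s = t it is tangent to the conic,
  but still a bisecant because of the axis point. The parameter \<open>c\<close> is 1 for Z and
  \<open>\<xi> ^ (2 * J)\<close> for B_J.\<close>

lemma bisecant_through_axis_point:
  fixes \<xi> :: "'a::field"
  assumes "d \<le> J" "\<xi> \<noteq> 0" "hpoint 1 0 (- c) \<in> E_set \<xi> J" "\<xi> ^ d * t = c"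
  shows "bisecant (E_set \<xi> J) (hline c (- (\<xi> ^ d + t)) 1)"
  unfolding bisecant_def
proof (intro conjI bexI)
  show "is_line (hline c (- (\<xi> ^ d + t)) 1)"
    unfolding is_line_def by (metis prod.inject zero_neq_one)
  show "hpoint 1 (\<xi> ^ d) ((\<xi> ^ d)\<^sup>2) \<noteq> hpoint 1 0 (- c)"
    using assms(2) by (auto dest: hpoint_eqD)
  show "hpoint 1 (\<xi> ^ d) ((\<xi> ^ d)\<^sup>2) \<in> hline c (- (\<xi> ^ d + t)) 1"
    using assms(4) by (intro hpoint_in_hline) (auto simp: algebra_simps power2_eq_square)
  show "hpoint 1 0 (- c) \<in> hline c (- (\<xi> ^ d + t)) 1"
    by (intro hpoint_in_hline) auto
qed (use assms D_point_in_E_set in auto)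

lemma bisecant_axis:
  assumes "\<xi> ^ (2 * J) \<noteq> 1"
  shows "bisecant (E_set \<xi> J) (hline 0 1 0)"
  unfolding bisecant_def
proof (intro conjI bexI)
  show "is_line (hline (0::'a) 1 0)"
    unfolding is_line_def by (metis prod.inject zero_neq_one)
  show "hpoint 1 0 (- 1) \<noteq> hpoint 1 0 (- (\<xi> ^ (2 * J)))"
    using assms by (auto dest: hpoint_eqD)
qed (auto simp: E_set_def intro!: hpoint_in_hline)

theorem theorem20:
  fixes q J :: nat and \<xi> :: "'a::{field, finite}"
  assumes "primepow q" and "q \<ge> 27" and "[q = 3] (mod 4)"
    and "CARD('a) = q"
    and "primitive_element \<xi>"
    and "(real q - 3) / 4 \<le> real J" and "real J \<le> (real q - 3) / 2"
  shows "\<forall>A \<in> hline (0::'a) 1 0 \<union> (conic - D_set \<xi> J).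
           \<exists>l. bisecant (E_set \<xi> J) l \<and> A \<in> l"
proof
  note prim = assms(5)
  define m where "m = (q - 1) div 2"
  have "q mod 4 = 3" using assms(3) by (simp add: cong_def)
  then have m: "q = 2 * m + 1" unfolding m_def by presburger
  \<comment> \<open>The second bound gives 2J < q - 1, which separates Z from B_J; the first closes
    the gaps between the intervals of exponents.\<close>
  have J: "m \<le> 2 * J + 1" "J + 1 \<le> m"
    using assms(6,7) m by auto
  have m0: "0 < m" "0 < J" using m assms(2) J by auto
  have nz: "\<xi> \<noteq> 0" using prim by (rule primitive_element_nonzero)
  have full: "\<xi> ^ (2 * m) = 1"
    using primitive_element_power_card[OF prim] assms(4) m by simp
  have half: "\<xi> ^ m = - 1"
    using primitive_element_power_half[OF prim] assms(4) m m0 by simp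
  have axis: "bisecant (E_set \<xi> J) (hline 0 1 0)"
    using primitive_element_power_ne_1[OF prim, of "2 * J"] assms(4) m m0 J
    by (intro bisecant_axis) simp
  fix A
  assume "A \<in> hline (0::'a) 1 0 \<union> (conic - D_set \<xi> J)"
  then consider "A \<in> hline 0 1 0" | "A \<in> conic" "A \<notin> hline 0 1 0" by blast
  then show "\<exists>l. bisecant (E_set \<xi> J) l \<and> A \<in> l"
  proof cases
    case 1
    with axis show ?thesis by blast
  next
    case 2
    then obtain x0 x1 x2 where A: "A = hpoint x0 x1 x2" "(x0, x1, x2) \<noteq> (0, 0, 0)"
      and x: "x1\<^sup>2 = x0 * x2"
      unfolding conic_def by blast
    have "x1 \<noteq> 0" using 2(2) A hpoint_in_hline[of x0 x1 x2 0 1 0] by auto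
    with x have "x0 \<noteq> 0" by auto
    define t where "t = x1 / x0"
    have x1: "x1 = t * x0" using \<open>x0 \<noteq> 0\<close> by (simp add: t_def)
    with x \<open>x0 \<noteq> 0\<close> have x2: "x2 = t\<^sup>2 * x0"
      by (auto simp: power2_eq_square mult.assoc)
    have "t \<noteq> 0" using \<open>x1 \<noteq> 0\<close> x1 by auto
    then obtain n where n: "n < 2 * m" "t = \<xi> ^ n"
      using obtain_primitive_element_exponent[OF prim] assms(4) m by auto
    have P: ?thesis if "d \<le> J" "t\<^sup>2 = (\<xi> ^ d)\<^sup>2" for d
      using bisecant_through_P[OF that(1), of \<xi>] that(2) A x2
        hpoint_in_hline[of x0 x1 x2 "- (\<xi> ^ d)\<^sup>2" 0 1] by auto
    have axis_point: ?thesis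
      if "d \<le> J" "\<xi> ^ d * t = c" "hpoint 1 0 (- c) \<in> E_set \<xi> J" for d c
    proof -
      have "c * x0 + - (\<xi> ^ d + t) * x1 + 1 * x2 = 0"
        unfolding x1 x2 that(2)[symmetric] by (simp add: algebra_simps power2_eq_square)
      then show ?thesis
        using bisecant_through_axis_point[OF that(1) nz that(3,2)] A hpoint_in_hline by blast
    qed
    \<comment> \<open>Both possible gaps, from 2J to m and from m + J to 2m - J, are excluded by the
      same inequality \<open>m \<le> 2 * J + 1\<close>.\<close>
    consider "n \<le> J" | "J \<le> n" "n \<le> 2 * J" | "m \<le> n" "n \<le> m + J" | "2 * m \<le> n + J"
      using J n(1) by linarith
    then show ?thesis
    proof cases
      case 1
      then show ?thesis using P n(2) by blast
    next
      case 2
      \<comment> \<open>The exponents of the two conic points add up to 2J, so the line passes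
        through B_J.\<close>
      then show ?thesis
        by (intro axis_point[of "2 * J - n" "\<xi> ^ (2 * J)"])
          (auto simp: n(2) E_set_def simp flip: power_add)
    next
      case 3
      \<comment> \<open>Shifting the exponent by m changes the sign, so t has the same square as a
        parameter of D_J.\<close>
      then have "t = - (\<xi> ^ (n - m))"
        using n(2) half power_add[of \<xi> m "n - m"] by simp
      with 3 show ?thesis by (intro P[of "n - m"]) auto
    next
      case 4
      \<comment> \<open>Here the exponents add up to 2m = q - 1, so the parameters are inverse to
        each other and the line passes through Z.\<close>
      then show ?thesis using n(1) full
        by (intro axis_point[of "2 * m - n" 1])
          (auto simp: n(2) E_set_def simp flip: power_add)
    qed
  qed
qed

end
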